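(* Let $\Gamma$ be a group and let $\preceq$ be an ordering on $\Gamma$. Then $\preceq$ is Conradian if and only if the ordered group $(\Gamma,\preceq)$ admits no crossing.
   Context: An ordering on a group $\Gamma$ is a total order relation on $\Gamma$ invariant under left multiplication. An element $f$ is positive if $f\succ 1$. The ordering $\preceq$ is Conradian if for all positive elements $f,g$ there exists $n\in\mathbb{N}$ (positive integers) such that $fg^n\succ g$. A crossing for $(\Gamma,\preceq)$ is a 5-uple $(f,g,u,v,w)$ of elements of $\Gamma$ such that: (i) $u\prec w\prec v$; (ii) $g^n u\prec v$ and $f^n v\succ u$ for every $n\in\mathbb{N}$; (iii) there exist $M,N\in\mathbb{N}$ such that $f^N v\prec w\prec g^M u$. *)

theory Defs
  imports "HOL-Algebra.Group"
begin

text \<open>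
  An ordering on a group is a relation \<open>r\<close>, where \<open>(x, y) \<in> r\<close> reads \<open>x \<preceq> y\<close>. Only left
  multiplication is required to preserve it; bi-invariance is not assumed.
\<close>

definition group_ordering :: "('a, 'b) monoid_scheme \<Rightarrow> 'a rel \<Rightarrow> bool" where
  "group_ordering G r \<longleftrightarrow>
     linear_order_on (carrier G) r \<and>
     (\<forall>h\<in>carrier G. \<forall>x\<in>carrier G. \<forall>y\<in>carrier G.
        (x, y) \<in> r \<longrightarrow> (h \<otimes>\<^bsub>G\<^esub> x, h \<otimes>\<^bsub>G\<^esub> y) \<in> r)"

definition strictly_below :: "'a rel \<Rightarrow> 'a \<Rightarrow> 'a \<Rightarrow> bool" where
  "strictly_below r x y \<longleftrightarrow> (x, y) \<in> r \<and> x \<noteq> y"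

definition positive_elem :: "('a, 'b) monoid_scheme \<Rightarrow> 'a rel \<Rightarrow> 'a \<Rightarrow> bool" where
  "positive_elem G r f \<longleftrightarrow> f \<in> carrier G \<and> strictly_below r \<one>\<^bsub>G\<^esub> f"

text \<open>In the next two definitions all exponents range over the positive integers.\<close>

definition conradian :: "('a, 'b) monoid_scheme \<Rightarrow> 'a rel \<Rightarrow> bool" where
  "conradian G r \<longleftrightarrow>
     (\<forall>f g. positive_elem G r f \<longrightarrow> positive_elem G r g \<longrightarrow>
        (\<exists>n::nat. n \<ge> 1 \<and> strictly_below r g (f \<otimes>\<^bsub>G\<^esub> g [^]\<^bsub>G\<^esub> n)))"

definition crossing ::
  "('a, 'b) monoid_scheme \<Rightarrow> 'a rel \<Rightarrow> 'a \<Rightarrow> 'a \<Rightarrow> 'a \<Rightarrow> 'a \<Rightarrow> 'a \<Rightarrow> bool" where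
  "crossing G r f g u v w \<longleftrightarrow>
     {f, g, u, v, w} \<subseteq> carrier G \<and>
     strictly_below r u w \<and> strictly_below r w v \<and>
     (\<forall>n::nat. n \<ge> 1 \<longrightarrow>
        strictly_below r (g [^]\<^bsub>G\<^esub> n \<otimes>\<^bsub>G\<^esub> u) v \<and>
        strictly_below r u (f [^]\<^bsub>G\<^esub> n \<otimes>\<^bsub>G\<^esub> v)) \<and>
     (\<exists>(M::nat) (N::nat). M \<ge> 1 \<and> N \<ge> 1 \<and>
        strictly_below r (f [^]\<^bsub>G\<^esub> N \<otimes>\<^bsub>G\<^esub> v) w \<and>
        strictly_below r w (g [^]\<^bsub>G\<^esub> M \<otimes>\<^bsub>G\<^esub> u))"

end

theory Submission
  imports Defs
begin

text \<open>
  Conrad's condition is about positive elements, that is, about elements that move \<open>\<one>\<close> upwards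
  in the action of the group on itself by left translations. Left translations preserve the
  ordering, so conjugation carries the condition from \<open>\<one>\<close> to any base point \<open>x\<close>: in a Conradian
  ordering, whenever \<open>p\<close> and \<open>q\<close> both move \<open>x\<close> upwards, some \<open>p q\<^sup>n\<close> with \<open>n \<ge> 1\<close> moves \<open>x\<close> beyond
  \<open>q x\<close> (lemma \<open>conradian_base_point\<close>).

  A crossing contradicts this with base point \<open>w\<close>. Let \<open>F = f\<^sup>N\<close> and \<open>H = g\<^sup>M\<close>, so that
  \<open>F v \<prec> w \<prec> H u\<close>, and put \<open>p = H F\<close> and \<open>q = H\<close>. Both move \<open>w\<close> upwards: \<open>H w\<close> lies above \<open>H u\<close>, and
  \<open>F w\<close> lies above \<open>F (F v)\<close>, hence above \<open>u\<close>, so that \<open>H F w\<close> also lies above \<open>H u\<close>. But the orbit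
  \<open>H\<^sup>n w\<close> stays below \<open>v\<close>, so \<open>F\<close> sends all of it below \<open>w\<close>, and \<open>H F H\<^sup>n w \<prec> H w\<close> for all \<open>n\<close>
  (lemma \<open>crossing_imp_not_conradian\<close>).

  Conversely, if \<open>f\<close> and \<open>g\<close> are positive and \<open>f g\<^sup>n \<preceq> g\<close> for all \<open>n \<ge> 1\<close>, then the powers of \<open>g\<close>
  are bounded by \<open>f\<inverse> g\<close>, a point that \<open>f\<close> moves down to \<open>g\<close>. So \<open>u = \<one>\<close>, \<open>w = g\<^sup>2\<close> and
  \<open>v = f\<inverse> g\<close> complete \<open>f\<close> and \<open>g\<close> to a crossing (lemma \<open>not_conradian_imp_crossing\<close>).
\<close>

locale left_ordered_group = group G for G (structure) +
  fixes r :: "'a rel"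
  assumes ordering: "group_ordering G r"
begin

abbreviation below (infix \<open>\<prec>\<close> 50) where
  "x \<prec> y \<equiv> strictly_below r x y"

lemma below_trans [trans]: "x \<prec> y \<Longrightarrow> y \<prec> z \<Longrightarrow> x \<prec> z"
  using ordering
  unfolding group_ordering_def linear_order_on_def partial_order_on_def preorder_on_def
    strictly_below_def
  by (metis antisymD transD)

lemma below_asym: "x \<prec> y \<Longrightarrow> \<not> y \<prec> x"
  using below_trans strictly_below_def by metis

lemma below_cases:
  assumes "x \<in> carrier G" "y \<in> carrier G"
  obtains "x \<prec> y" | "x = y" | "y \<prec> x"
  using assms ordering
  unfolding group_ordering_def linear_order_on_def total_on_def strictly_below_def
  by metis

lemma below_mult_left:
  assumes "x \<prec> y" "h \<in> carrier G" "x \<in> carrier G" "y \<in> carrier G"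
  shows "h \<otimes> x \<prec> h \<otimes> y"
  using assms ordering unfolding group_ordering_def strictly_below_def by simp

lemma below_mult_left_iff:
  assumes "h \<in> carrier G" "x \<in> carrier G" "y \<in> carrier G"
  shows "h \<otimes> x \<prec> h \<otimes> y \<longleftrightarrow> x \<prec> y"
proof
  assume "h \<otimes> x \<prec> h \<otimes> y"
  then have "inv h \<otimes> (h \<otimes> x) \<prec> inv h \<otimes> (h \<otimes> y)"
    by (rule below_mult_left) (use assms in auto)
  then show "x \<prec> y"
    using assms by (simp flip: m_assoc)
qed (use assms below_mult_left in blast)

lemma positive_imp_below_mult:
  assumes "positive_elem G r h" "x \<in> carrier G"
  shows "x \<prec> x \<otimes> h"
  using assms below_mult_left [of \<one> h x] unfolding positive_elem_def by simp

lemma positive_nat_pow_mult: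
  assumes "positive_elem G r f" "positive_elem G r g"
  shows "\<one> \<prec> f [^] (n::nat) \<otimes> g"
proof (induction n)
  case 0
  then show ?case using assms(2) unfolding positive_elem_def by simp
next
  case (Suc n)
  have f: "f \<in> carrier G" "\<one> \<prec> f" and g: "g \<in> carrier G"
    using assms unfolding positive_elem_def by auto
  have "f \<otimes> \<one> \<prec> f \<otimes> (f [^] n \<otimes> g)"
    by (rule below_mult_left) (use Suc f g in auto)
  also have "\<dots> = f [^] Suc n \<otimes> g"
    unfolding nat_pow_Suc2 [OF f(1)] using f g by (simp add: m_assoc)
  finally have "f \<prec> f [^] Suc n \<otimes> g"
    using f by simp
  with f(2) show ?case
    by (rule below_trans)
qed

lemma mult_inv_cancel_left:
  assumes "x \<in> carrier G" "y \<in> carrier G"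
  shows "x \<otimes> (inv x \<otimes> y) = y"
  using assms by (simp flip: m_assoc)

lemma conjugate_nat_pow:
  assumes "x \<in> carrier G" "q \<in> carrier G"
  shows "(inv x \<otimes> q \<otimes> x) [^] (n::nat) = inv x \<otimes> q [^] n \<otimes> x"
proof (induction n)
  case 0
  then show ?case using assms by simp
next
  case (Suc n)
  then show ?case
    using assms by (simp add: m_assoc mult_inv_cancel_left)
qed

text \<open>
  The elements \<open>x\<inverse> p x\<close> and \<open>x\<inverse> q x\<close> are positive, and left multiplication by \<open>x\<close> turns Conrad's
  inequality for them into the inequality at the base point \<open>x\<close>.
\<close>

lemma conradian_base_point:
  assumes conr: "conradian G r"
    and x: "x \<in> carrier G" and p: "p \<in> carrier G" and q: "q \<in> carrier G"
    and px: "x \<prec> p \<otimes> x" and qx: "x \<prec> q \<otimes> x"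
  obtains n :: nat where "n \<ge> 1" "q \<otimes> x \<prec> p \<otimes> (q [^] n \<otimes> x)"
proof -
  have pos: "positive_elem G r (inv x \<otimes> h \<otimes> x)" if "h \<in> carrier G" "x \<prec> h \<otimes> x" for h
  proof -
    have "inv x \<otimes> x \<prec> inv x \<otimes> (h \<otimes> x)"
      by (rule below_mult_left) (use that x in auto)
    then show ?thesis
      using that x unfolding positive_elem_def by (simp add: m_assoc)
  qed
  obtain n :: nat where n: "n \<ge> 1"
    "inv x \<otimes> q \<otimes> x \<prec> inv x \<otimes> p \<otimes> x \<otimes> (inv x \<otimes> q \<otimes> x) [^] n"
    using conr pos [OF p px] pos [OF q qx] unfolding conradian_def by blast
  have "inv x \<otimes> p \<otimes> x \<otimes> (inv x \<otimes> q \<otimes> x) [^] n = inv x \<otimes> (p \<otimes> (q [^] n \<otimes> x))"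
    unfolding conjugate_nat_pow [OF x q] using x p q by (simp add: m_assoc mult_inv_cancel_left)
  then have "inv x \<otimes> (q \<otimes> x) \<prec> inv x \<otimes> (p \<otimes> (q [^] n \<otimes> x))"
    using n(2) x q by (simp add: m_assoc)
  then have "q \<otimes> x \<prec> p \<otimes> (q [^] n \<otimes> x)"
    using below_mult_left_iff x p q by simp
  with n(1) show thesis by (rule that)
qed

lemma crossing_imp_not_conradian:
  assumes "crossing G r f g u v w"
  shows "\<not> conradian G r"
proof
  assume conr: "conradian G r"
  from assms have carr: "f \<in> carrier G" "g \<in> carrier G" "u \<in> carrier G" "v \<in> carrier G"
      "w \<in> carrier G"
    and uw: "u \<prec> w" and wv: "w \<prec> v"
    and gu: "\<And>n::nat. n \<ge> 1 \<Longrightarrow> g [^] n \<otimes> u \<prec> v"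
    and fv: "\<And>n::nat. n \<ge> 1 \<Longrightarrow> u \<prec> f [^] n \<otimes> v"
    unfolding crossing_def by auto
  from assms obtain M N :: nat where MN: "M \<ge> 1" "N \<ge> 1"
    and fNv: "f [^] N \<otimes> v \<prec> w" and gMu: "w \<prec> g [^] M \<otimes> u"
    unfolding crossing_def by auto
  define F where "F = f [^] N"
  define H where "H = g [^] M"
  have FH: "F \<in> carrier G" "H \<in> carrier G"
    unfolding F_def H_def using carr by auto
  have Fv: "F \<otimes> v \<prec> w" and wHu: "w \<prec> H \<otimes> u"
    using fNv gMu unfolding F_def H_def .
  have Hw: "w \<prec> H \<otimes> w"
    by (rule below_trans [OF wHu below_mult_left [OF uw]]) (use FH carr in auto)
  have "F \<otimes> (F \<otimes> v) \<prec> F \<otimes> w"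
    by (rule below_mult_left) (use Fv FH carr in auto)
  moreover have "u \<prec> F \<otimes> (F \<otimes> v)"
    using fv [of "N + N"] MN(2) carr unfolding F_def
    by (simp add: m_assoc flip: nat_pow_mult)
  ultimately have "u \<prec> F \<otimes> w"
    using below_trans by blast
  then have "H \<otimes> u \<prec> H \<otimes> (F \<otimes> w)"
    by (rule below_mult_left) (use FH carr in auto)
  with wHu have "w \<prec> H \<otimes> (F \<otimes> w)"
    by (rule below_trans)
  then have HFw: "w \<prec> H \<otimes> F \<otimes> w"
    using FH carr by (simp add: m_assoc)
  obtain n :: nat where n: "H \<otimes> w \<prec> H \<otimes> F \<otimes> (H [^] n \<otimes> w)"
    using conradian_base_point [OF conr, of w "H \<otimes> F" H] Hw HFw FH carr by blast
  \<comment> \<open>Since \<open>w \<prec> H u\<close>, the orbit of \<open>w\<close> under \<open>H\<close> inherits the bound \<open>v\<close> from the orbit of \<open>u\<close>.\<close>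
  have "H [^] n \<otimes> w \<prec> H [^] n \<otimes> (H \<otimes> u)"
    by (rule below_mult_left) (use wHu FH carr in auto)
  also have "\<dots> = H [^] Suc n \<otimes> u"
    using FH carr by (simp add: m_assoc)
  also have "\<dots> = g [^] (M * Suc n) \<otimes> u"
    unfolding H_def nat_pow_pow [OF carr(2)] ..
  also have "\<dots> \<prec> v"
    using gu MN(1) by simp
  finally have "F \<otimes> (H [^] n \<otimes> w) \<prec> F \<otimes> v"
    by (rule below_mult_left) (use FH carr in auto)
  then have "F \<otimes> (H [^] n \<otimes> w) \<prec> w"
    using Fv by (rule below_trans)
  then have "H \<otimes> (F \<otimes> (H [^] n \<otimes> w)) \<prec> H \<otimes> w"
    by (rule below_mult_left) (use FH carr in auto)
  then show False
    using n below_asym FH carr by (simp add: m_assoc)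
qed

lemma not_conradian_imp_crossing:
  assumes "\<not> conradian G r"
  obtains f g u v w where "crossing G r f g u v w"
proof -
  obtain f g where pos: "positive_elem G r f" "positive_elem G r g"
    and no: "\<And>n::nat. n \<ge> 1 \<Longrightarrow> \<not> g \<prec> f \<otimes> g [^] n"
    using assms unfolding conradian_def by blast
  have carr: "f \<in> carrier G" "g \<in> carrier G"
    using pos unfolding positive_elem_def by auto
  have pow_Suc: "g [^] n \<prec> g [^] Suc n" for n :: nat
    using positive_imp_below_mult [OF pos(2)] carr by simp
  \<comment> \<open>Conrad's condition fails strictly: if \<open>f g\<^sup>n = g\<close>, then \<open>f g\<^sup>n\<^sup>+\<^sup>1\<close> lies above \<open>g\<close>.\<close>
  have strict: "f \<otimes> g [^] n \<prec> g" if n: "n \<ge> 1" for n :: nat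
  proof -
    have "f \<otimes> g [^] n \<prec> f \<otimes> g [^] Suc n"
      by (rule below_mult_left) (use pow_Suc carr in auto)
    then have "f \<otimes> g [^] n \<noteq> g"
      using no [of "Suc n"] by auto
    then show ?thesis
      using no [OF n] below_cases [of "f \<otimes> g [^] n" g] carr by auto
  qed
  define v where "v = inv f \<otimes> g"
  have v: "v \<in> carrier G" and fv: "f \<otimes> v = g"
    using carr unfolding v_def by (simp_all flip: m_assoc)
  have pow_below_v: "g [^] n \<prec> v" if "n \<ge> 1" for n :: nat
    using strict [OF that] below_mult_left_iff [of f "g [^] n" v] carr v fv by simp
  have fpow_v: "\<one> \<prec> f [^] n \<otimes> v" if n: "n \<ge> 1" for n :: nat
  proof -
    obtain m where m: "n = Suc m" using n by (cases n) auto
    have "f [^] n \<otimes> v = f [^] m \<otimes> g"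
      using carr v fv m by (simp add: m_assoc)
    then show ?thesis using positive_nat_pow_mult [OF pos] by simp
  qed
  have one_g2: "\<one> \<prec> g [^] (2::nat)"
    using below_trans [OF pow_Suc [of 0] pow_Suc [of "Suc 0"]] by (simp add: numeral_2_eq_2)
  have M: "g [^] (2::nat) \<prec> g [^] (3::nat) \<otimes> \<one>"
    using pow_Suc [of 2] carr by (simp add: numeral_3_eq_3 numeral_2_eq_2)
  have N: "f [^] (1::nat) \<otimes> v \<prec> g [^] (2::nat)"
    using pow_Suc [of 1] carr fv by (simp add: numeral_2_eq_2)
  have "crossing G r f g \<one> v (g [^] (2::nat))"
    unfolding crossing_def
  proof (intro conjI allI impI)
    show "\<exists>(M::nat) N::nat. 1 \<le> M \<and> 1 \<le> N \<and> f [^] N \<otimes> v \<prec> g [^] (2::nat)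
        \<and> g [^] (2::nat) \<prec> g [^] M \<otimes> \<one>"
      using M N by (intro exI [of _ 3] exI [of _ 1]) auto
  qed (use carr v one_g2 pow_below_v fpow_v in auto)
  then show thesis by (rule that)
qed

end

theorem theorem1p4:
  fixes G :: "('a, 'b) monoid_scheme" and r :: "'a rel"
  assumes "group G"
    and "group_ordering G r"
  shows "conradian G r \<longleftrightarrow> \<not> (\<exists>f g u v w. crossing G r f g u v w)"
proof -
  interpret left_ordered_group G r
    using assms by (simp add: left_ordered_group_def left_ordered_group_axioms_def)
  show ?thesis
    using crossing_imp_not_conradian not_conradian_imp_crossing by metis
qed

end
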